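(* A Banach space $X$ is reflexive if and only if there exists a closed cone $P$ of $X$ such that both $P$ (as a cone of $X$) and its dual cone $P^0$ (as a cone of $X^*$) are reflexive cones.
   Context: All spaces are real. $B_X$ is the closed unit ball of $X$. A cone of $X$ is a nonempty convex set $P\subseteq X$ with $\lambda P\subseteq P$ for every real $\lambda\ge 0$ (it need not be pointed). A cone $P$ of a Banach space $X$ is reflexive if $P\cap B_X$ is weakly compact. The dual cone of $P$ is $P^0=\{x^*\in X^*: x^*(x)\ge 0 \text{ for each } x\in P\}$. *)

theory Defs
  imports "HOL-Analysis.Analysis"
begin

text \<open>The topological dual of a real normed space \<^typ>\<open>'a\<close> is the type
  \<^typ>\<open>'a \<Rightarrow>\<^sub>L real\<close> of bounded linear functionals with the operator norm.\<close>

text \<open>The weak topology is the initial topology for all bounded linear functionals: the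
  topology pulled back from the product topology, which is the topology of the function type
  \<^typ>\<open>('a \<Rightarrow>\<^sub>L real) \<Rightarrow> real\<close>, along \<open>x \<mapsto> (f \<mapsto> f x)\<close>.\<close>

definition weak_topology :: "'a::real_normed_vector topology"
  where "weak_topology =
    pullback_topology UNIV (\<lambda>x (f :: 'a \<Rightarrow>\<^sub>L real). blinfun_apply f x) euclidean"

lemma topspace_weak_topology [simp]: "topspace weak_topology = UNIV"
  unfolding weak_topology_def by (simp add: topspace_pullback_topology)

lemma continuous_map_weak_topology_iff:
  "continuous_map T weak_topology g \<longleftrightarrow>
    (\<forall>f :: 'a::real_normed_vector \<Rightarrow>\<^sub>L real.
      continuous_map T euclideanreal (\<lambda>t. blinfun_apply f (g t)))"
proof -
  let ?e = "\<lambda>x (f :: 'a \<Rightarrow>\<^sub>L real). blinfun_apply f x"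
  have "continuous_map T weak_topology g \<longleftrightarrow> continuous_map T euclidean (?e \<circ> g)"
  proof
    assume "continuous_map T weak_topology g"
    then show "continuous_map T euclidean (?e \<circ> g)"
      unfolding weak_topology_def
      by (rule continuous_map_compose[OF _ continuous_map_pullback[OF continuous_map_id, simplified]])
  next
    assume "continuous_map T euclidean (?e \<circ> g)"
    then show "continuous_map T weak_topology g"
      unfolding weak_topology_def by (rule continuous_map_pullback') simp
  qed
  also have "\<dots> \<longleftrightarrow> (\<forall>f. continuous_map T euclideanreal (\<lambda>t. blinfun_apply f (g t)))"
    unfolding euclidean_product_topology[symmetric] continuous_map_componentwise_UNIV o_def ..
  finally show ?thesis .
qed

definition bidual_embedding :: "'a::real_normed_vector \<Rightarrow> (('a \<Rightarrow>\<^sub>L real) \<Rightarrow>\<^sub>L real)"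
  where "bidual_embedding x = Blinfun (\<lambda>f. blinfun_apply f x)"

lemma blinfun_apply_bidual_embedding [simp]:
  "blinfun_apply (bidual_embedding x) f = blinfun_apply f x"
  unfolding bidual_embedding_def
  by (simp add: bounded_linear_Blinfun_apply blinfun.bounded_linear_left)

definition reflexive_space :: "'a::real_normed_vector itself \<Rightarrow> bool"
  where "reflexive_space _ \<longleftrightarrow>
    surj (bidual_embedding :: 'a \<Rightarrow> (('a \<Rightarrow>\<^sub>L real) \<Rightarrow>\<^sub>L real))"

text \<open>A cone is a nonempty convex set closed under multiplication by nonnegative reals, which
  is \<^const>\<open>convex_cone\<close>; the library's \<^const>\<open>cone\<close> requires neither
  convexity nor nonemptiness.\<close>

definition reflexive_cone :: "'a::real_normed_vector set \<Rightarrow> bool"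
  where "reflexive_cone P \<longleftrightarrow> convex_cone P \<and> compactin weak_topology (P \<inter> cball 0 1)"

definition dual_cone :: "'a::real_normed_vector set \<Rightarrow> ('a \<Rightarrow>\<^sub>L real) set"
  where "dual_cone P = {f. \<forall>x\<in>P. blinfun_apply f x \<ge> 0}"

end

theory Submission
  imports Defs
begin

text \<open>Write \<open>J\<close> for the canonical embedding of a space into its bidual.

If the space is reflexive, the cone \<open>{0}\<close> works: its dual cone is the whole dual
space, whose unit ball is weak-star compact by the Banach-Alaoglu theorem, and reflexivity turns
this into weak compactness.

Conversely, let \<open>P\<close> and its dual cone \<open>W\<close> be reflexive cones, and let
\<open>F\<close> be a functional on the bidual, of norm at most one, that vanishes on the range of
\<open>J\<close>. The aim is \<open>F = 0\<close>: as the range of \<open>J\<close> is a closed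
subspace, the Hahn-Banach theorem then shows that it is the whole bidual. Suppose that \<open>F\<close>
is evaluation at some \<open>f \<in> W\<close>. Then \<open>f x = F (J x) = 0\<close> for all
\<open>x\<close>, so \<open>f = 0\<close> and \<open>F = 0\<close>. To see that \<open>F\<close>
is such an evaluation, compare it with the evaluations at the unit ball of \<open>W\<close>, which
form a weak-star compact convex set because \<open>W\<close> is reflexive. By the separation lemma
\<open>weak_star_compact_separation\<close> it suffices that every \<open>\<phi>\<close> in the
bidual satisfies \<open>F \<phi> \<le> s\<close>, where \<open>s\<close> is the maximum of
\<open>\<phi>\<close> on the unit ball of \<open>W\<close>. Since \<open>F\<close> vanishes on
\<open>J P\<close> and has norm at most one, \<open>F \<phi>\<close> is at most the distance of
\<open>\<phi>\<close> from \<open>- J P\<close>, and this distance is at most \<open>s\<close>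
by \<open>dual_cone_distance\<close>.

That last inequality is the quantitative heart and the place where reflexivity of \<open>P\<close>
is used: the truncations of \<open>J P\<close> by balls are weak-star compact, so a bidual point too far
from them is separated from them by an element of the dual, which nearly lies in \<open>W\<close> and
can be corrected to lie in \<open>W\<close> by \<open>near_dual_cone\<close>.\<close>

section \<open>Sublinear functionals and the Hahn-Banach theorem\<close>

definition sublinear :: "('a::real_vector \<Rightarrow> real) \<Rightarrow> bool"
  where "sublinear p \<longleftrightarrow>
    (\<forall>x y. p (x + y) \<le> p x + p y) \<and> (\<forall>c x. c \<ge> 0 \<longrightarrow> p (c *\<^sub>R x) = c * p x)"

lemma sublinear_add: "sublinear p \<Longrightarrow> p (x + y) \<le> p x + p y"
  and sublinear_scaleR: "sublinear p \<Longrightarrow> c \<ge> 0 \<Longrightarrow> p (c *\<^sub>R x) = c * p x"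
  by (auto simp: sublinear_def)

lemma sublinear_0: "sublinear p \<Longrightarrow> p 0 = 0"
  using sublinear_scaleR[of p 0 0] by simp

lemma sublinear_minus: "sublinear p \<Longrightarrow> - p (- x) \<le> p x"
  using sublinear_add[of p x "- x"] sublinear_0[of p] by simp

lemma sublinearI:
  assumes "p 0 = 0" and "\<And>x y. p (x + y) \<le> p x + p y"
    and scale: "\<And>c x. c > 0 \<Longrightarrow> p (c *\<^sub>R x) \<le> c * p x"
  shows "sublinear p"
  unfolding sublinear_def
proof (intro conjI allI impI)
  fix c :: real and x
  assume "c \<ge> 0"
  show "p (c *\<^sub>R x) = c * p x"
  proof (cases "c = 0")
    case False
    then have "c > 0" using \<open>c \<ge> 0\<close> by simp
    moreover have "p ((1 / c) *\<^sub>R c *\<^sub>R x) \<le> 1 / c * p (c *\<^sub>R x)"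
      using \<open>c > 0\<close> by (intro scale) simp
    ultimately have "c * p x \<le> p (c *\<^sub>R x)"
      by (simp add: field_simps)
    then show ?thesis
      using scale[OF \<open>c > 0\<close>, of x] by linarith
  qed (use assms(1) in simp)
qed (use assms(2) in auto)

text \<open>This is the infimal convolution of \<open>p\<close> with the function \<open>y \<mapsto> - g (- y)\<close>,
where \<open>g c\<close> is the supremum of the \<open>t\<close> with \<open>(c, t) \<in> G\<close>. For a
convex cone \<open>G\<close> below \<open>p\<close>, a linear functional below it lies below
\<open>p\<close> and, by \<open>cone_lowering_uminus\<close>, above \<open>G\<close>. Using a set of pairs
for \<open>G\<close> lets a cone be given by its generators, without expressing the value \<open>t\<close> as a
function of \<open>c\<close>.\<close>

definition cone_lowering :: "('a::real_vector \<times> real) set \<Rightarrow> ('a \<Rightarrow> real) \<Rightarrow> 'a \<Rightarrow> real"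
  where "cone_lowering G p x = (INF z\<in>G. p (x + fst z) - snd z)"

context
  fixes G :: "('a::real_vector \<times> real) set" and p :: "'a \<Rightarrow> real"
  assumes G: "convex_cone G" and p: "sublinear p"
    and below: "\<And>c t. (c, t) \<in> G \<Longrightarrow> t \<le> p c"
begin

text \<open>The infimum is finite because \<open>G\<close> lies below the graph of \<open>p\<close>.\<close>

lemma cone_lowering_bdd: "z \<in> G \<Longrightarrow> - p (- x) \<le> p (x + fst z) - snd z"
  using sublinear_add[OF p, of "x + fst z" "- x"] below[of "fst z" "snd z"] by simp

lemma cone_lowering_le: "(c, t) \<in> G \<Longrightarrow> cone_lowering G p x \<le> p (x + c) - t"
  unfolding cone_lowering_def
  using cone_lowering_bdd by (intro cINF_lower2[where x="(c, t)"]) (auto intro!: bdd_belowI2)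

lemma cone_lowering_greatest:
  "(\<And>c t. (c, t) \<in> G \<Longrightarrow> a \<le> p (x + c) - t) \<Longrightarrow> a \<le> cone_lowering G p x"
  unfolding cone_lowering_def
  using convex_cone_nonempty[OF G] by (intro cINF_greatest) auto

lemma cone_lowering_le_self: "cone_lowering G p x \<le> p x"
  using cone_lowering_le[of 0 0 x] convex_cone_contains_0[OF G] by (simp add: zero_prod_def)

lemma cone_lowering_uminus: "(c, t) \<in> G \<Longrightarrow> cone_lowering G p (- c) \<le> - t"
  using cone_lowering_le[of c t "- c"] sublinear_0[OF p] by simp

lemma sublinear_cone_lowering: "sublinear (cone_lowering G p)"
proof (rule sublinearI)
  show "cone_lowering G p 0 = 0"
    using cone_lowering_le_self[of 0] cone_lowering_greatest[of 0 0] below sublinear_0[OF p]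
    by fastforce
next
  fix x y
  have *: "cone_lowering G p (x + y) - (p (x + c) - t) \<le> p (y + d) - u"
    if "(c, t) \<in> G" "(d, u) \<in> G" for c t d u
  proof -
    have "(c + d, t + u) \<in> G"
      using convex_cone_add[OF G that] by simp
    then show ?thesis
      using cone_lowering_le[of "c + d" "t + u" "x + y"] sublinear_add[OF p, of "x + c" "y + d"]
      by (simp add: algebra_simps)
  qed
  have "cone_lowering G p (x + y) - cone_lowering G p y \<le> p (x + c) - t" if "(c, t) \<in> G" for c t
    using cone_lowering_greatest[OF *[OF that]] by linarith
  from cone_lowering_greatest[OF this]
  show "cone_lowering G p (x + y) \<le> cone_lowering G p x + cone_lowering G p y"
    by linarith
next
  fix r :: real and x
  assume "r > 0"
  have "cone_lowering G p (r *\<^sub>R x) / r \<le> p (x + c) - t" if "(c, t) \<in> G" for c t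
  proof -
    have "(r *\<^sub>R c, r * t) \<in> G"
      using convex_cone_scaleR[OF G _ that, of r] \<open>r > 0\<close> by simp
    from cone_lowering_le[OF this, of "r *\<^sub>R x"]
    have "cone_lowering G p (r *\<^sub>R x) \<le> r * (p (x + c) - t)"
      using sublinear_scaleR[OF p, of r "x + c"] \<open>r > 0\<close> by (simp add: algebra_simps)
    then show ?thesis
      using \<open>r > 0\<close> by (simp add: field_simps)
  qed
  from cone_lowering_greatest[OF this]
  show "cone_lowering G p (r *\<^sub>R x) \<le> r * cone_lowering G p x"
    using \<open>r > 0\<close> by (simp add: field_simps)
qed

end

text \<open>Subadditivity survives the infimum because, of two members of a chain, the smaller one can be
used at both arguments. The common lower bound \<open>b\<close> keeps the infimum finite.\<close>

lemma sublinear_INF_chain: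
  assumes "C \<noteq> {}" and sub: "\<And>q. q \<in> C \<Longrightarrow> sublinear q"
    and chain: "\<And>q r. q \<in> C \<Longrightarrow> r \<in> C \<Longrightarrow> q \<le> r \<or> r \<le> q"
    and lower: "\<And>q x. q \<in> C \<Longrightarrow> b x \<le> q x"
  shows "sublinear (\<lambda>x. INF q\<in>C. q x)" and "\<And>q x. q \<in> C \<Longrightarrow> (INF q\<in>C. q x) \<le> q x"
proof -
  show le: "(INF q\<in>C. q x) \<le> q x" if "q \<in> C" for q x
    using that lower by (intro cINF_lower) (auto intro!: bdd_belowI2)
  have greatest: "a \<le> (INF q\<in>C. q x)" if "\<And>q. q \<in> C \<Longrightarrow> a \<le> q x" for a x
    using that \<open>C \<noteq> {}\<close> by (intro cINF_greatest) auto
  show "sublinear (\<lambda>x. INF q\<in>C. q x)"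
  proof (rule sublinearI)
    show "(INF q\<in>C. q 0) = (0::real)"
    proof -
      have "(\<lambda>q. q 0) ` C = {0}"
        using \<open>C \<noteq> {}\<close> sub sublinear_0 by force
      then show ?thesis by simp
    qed
  next
    fix x y
    have *: "(INF q\<in>C. q (x + y)) - r x \<le> s y" if "r \<in> C" "s \<in> C" for r s
    proof -
      have "r \<le> s \<or> s \<le> r"
        using chain that by blast
      with that obtain q where "q \<in> C" "q \<le> r" "q \<le> s"
        by blast
      then show ?thesis
        using le[OF \<open>q \<in> C\<close>, of "x + y"] sublinear_add[OF sub[OF \<open>q \<in> C\<close>], of x y]
        by (smt (verit) le_funD)
    qed
    have "(INF q\<in>C. q (x + y)) - r x \<le> (INF q\<in>C. q y)" if "r \<in> C" for r
      by (rule greatest) (rule *[OF that])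
    then have "(INF q\<in>C. q (x + y)) - (INF q\<in>C. q y) \<le> (INF q\<in>C. q x)"
      by (intro greatest) (simp add: algebra_simps)
    then show "(INF q\<in>C. q (x + y)) \<le> (INF q\<in>C. q x) + (INF q\<in>C. q y)"
      by linarith
  next
    fix c :: real and x
    assume "c > 0"
    have "(INF q\<in>C. q (c *\<^sub>R x)) / c \<le> q x" if "q \<in> C" for q
      using le[OF that, of "c *\<^sub>R x"] sublinear_scaleR[OF sub[OF that], of c x] \<open>c > 0\<close>
      by (simp add: field_simps)
    then have "(INF q\<in>C. q (c *\<^sub>R x)) / c \<le> (INF q\<in>C. q x)"
      by (rule greatest)
    then show "(INF q\<in>C. q (c *\<^sub>R x)) \<le> c * (INF q\<in>C. q x)"
      using \<open>c > 0\<close> by (simp add: field_simps)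
  qed
qed

text \<open>Lowering \<open>q\<close> along the ray through \<open>y\<close> and its value \<open>q y\<close>
yields a sublinear functional below \<open>q\<close>. By minimality it is \<open>q\<close> itself,
which says \<open>q x + q y \<le> q (x + y)\<close>, so \<open>q\<close> is additive.\<close>

lemma minimal_sublinear_imp_linear:
  assumes q: "sublinear q" and min: "\<And>r. sublinear r \<Longrightarrow> r \<le> q \<Longrightarrow> r = q"
  shows "linear q"
proof -
  have super: "q x + q y \<le> q (x + y)" for x y
  proof -
    define G where "G = (\<lambda>t. (t *\<^sub>R y, t * q y)) ` {0..}"
    have G: "convex_cone G"
      unfolding convex_cone_iff G_def
      by (auto simp: image_iff zero_prod_def scaleR_add_left[symmetric] distrib_right[symmetric]
          intro: exI[of _ 0] bexI[of _ 0] add_nonneg_nonneg mult_nonneg_nonneg)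
    have "cone_lowering G q = q"
      using sublinear_scaleR[OF q]
      by (intro min sublinear_cone_lowering le_funI cone_lowering_le_self G q) (auto simp: G_def)
    moreover have "(y, q y) \<in> G"
      unfolding G_def by (rule image_eqI[where x=1]) auto
    then have "cone_lowering G q x \<le> q (x + y) - q y"
      using sublinear_scaleR[OF q] by (intro cone_lowering_le G q) (auto simp: G_def)
    ultimately show ?thesis by simp
  qed
  have add: "q (x + y) = q x + q y" for x y
    using super[of x y] sublinear_add[OF q, of x y] by linarith
  have neg: "q (- x) = - q x" for x
    using add[of x "- x"] sublinear_0[OF q] by simp
  show ?thesis
  proof (rule linearI)
    fix c x
    show "q (c *\<^sub>R x) = c *\<^sub>R q x"
      using sublinear_scaleR[OF q, of "\<bar>c\<bar>" x] neg[of "c *\<^sub>R x"]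
      by (cases "c \<ge> 0") auto
  qed (rule add)
qed

text \<open>This is the Hahn-Banach theorem: Zorn's lemma gives a minimal sublinear functional below
\<open>p\<close>, which is linear. Chains have lower bounds because all sublinear \<open>q \<le> p\<close> share the
common lower bound \<open>- p (- x)\<close>, since \<open>q x \<ge> - q (- x)\<close>.\<close>

lemma exists_linear_below_sublinear:
  fixes p :: "'a::real_vector \<Rightarrow> real"
  assumes p: "sublinear p"
  obtains f where "linear f" and "\<And>x. f x \<le> p x"
proof -
  define A where "A = {q. sublinear q \<and> q \<le> p}"
  have "\<exists>m\<in>A. \<forall>a\<in>A. a \<le> m \<longrightarrow> a = m"
  proof (rule predicate_Zorn[where P="\<lambda>a b. b \<le> a"])
    show "partial_order_on A (relation_of (\<lambda>a b. b \<le> a) A)"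
      by (rule partial_order_on_relation_ofI) auto
  next
    fix C assume C: "C \<in> Chains (relation_of (\<lambda>a b. b \<le> a) A)"
    have CA: "C \<subseteq> A"
      using C by (auto simp: Chains_def relation_of_def)
    show "\<exists>u\<in>A. \<forall>a\<in>C. u \<le> a"
    proof (cases "C = {}")
      case True
      then show ?thesis using p by (auto simp: A_def)
    next
      case False
      have sub: "\<And>q. q \<in> C \<Longrightarrow> sublinear q"
        using CA by (auto simp: A_def)
      have chain: "\<And>q r. q \<in> C \<Longrightarrow> r \<in> C \<Longrightarrow> q \<le> r \<or> r \<le> q"
        using C by (auto simp: Chains_def relation_of_def)
      have lower: "- p (- x) \<le> q x" if "q \<in> C" for q x
      proof -
        have "q (- x) \<le> p (- x)"
          using that CA by (auto simp: A_def le_fun_def)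
        then show ?thesis
          using sublinear_minus[OF sub[OF that], of x] by linarith
      qed
      have inf_sub: "sublinear (\<lambda>x. INF q\<in>C. q x)"
        by (rule sublinear_INF_chain(1)[where b="\<lambda>x. - p (- x)"])
          (use False sub chain lower in auto)
      have inf_le: "(INF q\<in>C. q x) \<le> q x" if "q \<in> C" for q x
        by (rule sublinear_INF_chain(2)[where b="\<lambda>x. - p (- x)"])
          (use False sub chain lower that in auto)
      obtain q where "q \<in> C" using False by blast
      then have "q \<le> p" using CA by (auto simp: A_def)
      have "(\<lambda>x. INF q\<in>C. q x) \<le> p"
      proof (rule le_funI)
        fix x
        show "(INF q\<in>C. q x) \<le> p x"
          using inf_le[OF \<open>q \<in> C\<close>, of x] le_funD[OF \<open>q \<le> p\<close>, of x] by linarith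
      qed
      then have "(\<lambda>x. INF q\<in>C. q x) \<in> A"
        using inf_sub by (simp add: A_def)
      moreover have "\<forall>a\<in>C. (\<lambda>x. INF q\<in>C. q x) \<le> a"
        using inf_le by (intro ballI le_funI)
      ultimately show ?thesis by blast
    qed
  qed
  then obtain m where "sublinear m" "m \<le> p" and "\<And>a. a \<in> A \<Longrightarrow> a \<le> m \<Longrightarrow> a = m"
    unfolding A_def by blast
  moreover from this have "linear m"
    by (intro minimal_sublinear_imp_linear) (auto simp: A_def)
  ultimately show ?thesis
    using that[of m] by (auto simp: le_fun_def)
qed

text \<open>The one separation statement from which the later uses of the Hahn-Banach theorem on normed spaces
are derived, each by its own choice of the cone \<open>G\<close>.\<close>

theorem sandwich_linear:
  fixes p :: "'a::real_vector \<Rightarrow> real"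
  assumes G: "convex_cone G" and p: "sublinear p"
    and below: "\<And>c t. (c, t) \<in> G \<Longrightarrow> t \<le> p c"
  obtains f where "linear f" and "\<And>x. f x \<le> p x" and "\<And>c t. (c, t) \<in> G \<Longrightarrow> t \<le> f c"
proof -
  obtain f where f: "linear f" "\<And>x. f x \<le> cone_lowering G p x"
    using exists_linear_below_sublinear[OF sublinear_cone_lowering[OF G p below]] by blast
  have "f x \<le> p x" for x
    using f(2)[of x] cone_lowering_le_self[OF G p below, of x] by simp
  moreover have "t \<le> f c" if "(c, t) \<in> G" for c t
    using f(2)[of "- c"] cone_lowering_uminus[OF G p below that] linear_neg[OF f(1), of c] by simp
  ultimately show ?thesis
    using that f(1) by blast
qed

corollary sandwich_blinfun:
  fixes G :: "('a::real_normed_vector \<times> real) set"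
  assumes G: "convex_cone G" and "e \<ge> 0"
    and below: "\<And>c t. (c, t) \<in> G \<Longrightarrow> t \<le> e * norm c"
  obtains f :: "'a \<Rightarrow>\<^sub>L real" where "norm f \<le> e" and "\<And>c t. (c, t) \<in> G \<Longrightarrow> t \<le> f c"
proof -
  have "sublinear (\<lambda>x :: 'a. e * norm x)"
    using \<open>e \<ge> 0\<close> by (auto simp: sublinear_def distrib_left[symmetric] intro!: mult_left_mono norm_triangle_ineq)
  then obtain g where g: "linear g" "\<And>x. g x \<le> e * norm x" "\<And>c t. (c, t) \<in> G \<Longrightarrow> t \<le> g c"
    using sandwich_linear[where p="\<lambda>x. e * norm x", OF G _ below] by blast
  have bound: "\<bar>g x\<bar> \<le> e * norm x" for x
    using g(2)[of x] g(2)[of "- x"] linear_neg[OF g(1), of x] by simp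
  then have "bounded_linear g"
    using g(1) by (intro bounded_linear_intro[where K=e])
      (auto simp: linear_add linear_scale mult.commute)
  then have g_eq: "blinfun_apply (Blinfun g) = g"
    by (rule bounded_linear_Blinfun_apply)
  then have "norm (Blinfun g) \<le> e"
    using bound \<open>e \<ge> 0\<close> by (intro norm_blinfun_bound) auto
  then show ?thesis
    using that[of "Blinfun g"] g(3) g_eq by simp
qed

corollary annihilating_functional:
  fixes M :: "'a::real_normed_vector set"
  assumes M: "subspace M" and "closed M" and "v \<notin> M"
  obtains f :: "'a \<Rightarrow>\<^sub>L real" where "norm f \<le> 1" and "\<And>m. m \<in> M \<Longrightarrow> f m = 0" and "f v \<noteq> 0"
proof -
  define d where "d = infdist v M"
  have "0 \<in> M" using M by (rule subspace_0)
  have "d > 0"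
    unfolding d_def using assms \<open>0 \<in> M\<close> by (intro infdist_pos_not_in_closed) auto
  \<comment> \<open>The cone forces a functional to be nonnegative on the subspace \<open>M\<close>, hence zero there,
and at least \<open>d\<close> at \<open>v\<close>; the norm dominates it because \<open>v\<close> has
distance \<open>d\<close> from \<open>M\<close>.\<close>
  define G where "G = {(m + t *\<^sub>R v, t * d) |m t. m \<in> M \<and> t \<ge> 0}"
  have G: "convex_cone G"
    unfolding convex_cone_iff
  proof (intro conjI ballI allI impI)
    show "0 \<in> G"
      using \<open>0 \<in> M\<close> unfolding G_def by (auto simp: zero_prod_def intro!: exI[of _ 0])
  next
    fix y z assume "y \<in> G" "z \<in> G"
    then obtain m t n u where "y = (m + t *\<^sub>R v, t * d)" "z = (n + u *\<^sub>R v, u * d)"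
      "m \<in> M" "n \<in> M" "t \<ge> 0" "u \<ge> 0" unfolding G_def by blast
    then show "y + z \<in> G"
      using subspace_add[OF M] unfolding G_def
      by (auto simp: algebra_simps intro!: exI[of _ "m + n"] exI[of _ "t + u"])
  next
    fix y and c :: real assume "y \<in> G" "c \<ge> 0"
    then obtain m t where "y = (m + t *\<^sub>R v, t * d)" "m \<in> M" "t \<ge> 0" unfolding G_def by blast
    then show "c *\<^sub>R y \<in> G"
      using subspace_scale[OF M] \<open>c \<ge> 0\<close> unfolding G_def
      by (auto simp: algebra_simps intro!: exI[of _ "c *\<^sub>R m"] exI[of _ "c * t"])
  qed
  have bound: "t * d \<le> norm (m + t *\<^sub>R v)" if "m \<in> M" "t \<ge> 0" for m t
  proof (cases "t = 0")
    case False
    then have "t > 0" using that by simp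
    have "- (1 / t) *\<^sub>R m \<in> M"
      using subspace_scale[OF M] that by blast
    then have "d \<le> norm (v + (1 / t) *\<^sub>R m)"
      unfolding d_def by (metis infdist_le dist_norm scaleR_minus_left diff_minus_eq_add)
    then have "t * d \<le> norm (t *\<^sub>R (v + (1 / t) *\<^sub>R m))"
      using \<open>t > 0\<close> by simp
    also have "t *\<^sub>R (v + (1 / t) *\<^sub>R m) = m + t *\<^sub>R v"
      using \<open>t > 0\<close> by (simp add: algebra_simps)
    finally show ?thesis .
  qed simp
  have "t \<le> 1 * norm c" if "(c, t) \<in> G" for c t
    using that bound by (auto simp: G_def)
  then obtain f :: "'a \<Rightarrow>\<^sub>L real"
    where f: "norm f \<le> 1" and fG: "\<And>c t. (c, t) \<in> G \<Longrightarrow> t \<le> f c"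
    using sandwich_blinfun[OF G zero_le_one] by blast
  have nonneg: "0 \<le> f m" if "m \<in> M" for m
  proof (rule fG)
    show "(m, 0) \<in> G"
      unfolding G_def using that by (intro CollectI exI[of _ m] exI[of _ "0::real"]) auto
  qed
  have "f m = 0" if "m \<in> M" for m
    using nonneg[OF that] nonneg[OF subspace_neg[OF M that]] by (simp add: blinfun.minus_right)
  moreover have "d \<le> f v"
  proof (rule fG)
    show "(v, d) \<in> G"
      unfolding G_def using \<open>0 \<in> M\<close> by (intro CollectI exI[of _ 0] exI[of _ "1::real"]) auto
  qed
  ultimately show ?thesis
    using that f \<open>d > 0\<close> by force
qed

section \<open>Weak and weak-star compactness\<close>

lemma continuous_on_coordinate: "continuous_on S (\<lambda>u :: 'a \<Rightarrow> real. u i)"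
  by (rule continuous_on_subset[OF continuous_on_product_coordinates]) simp

text \<open>Weak compactness of \<open>S\<close> is weak-star compactness of its canonical image in the bidual,
expressed as compactness of a set of functions under pointwise convergence. In this form compact
sets can be moved by continuous maps between function spaces.\<close>

lemma compactin_weak_topology_iff:
  "compactin weak_topology S \<longleftrightarrow> compact (blinfun_apply ` bidual_embedding ` S)"
  (is "?L \<longleftrightarrow> ?R")
proof -
  let ?e = "\<lambda>x (f :: 'a \<Rightarrow>\<^sub>L real). blinfun_apply f x"
  have image: "blinfun_apply ` bidual_embedding ` S = ?e ` S"
    by (auto simp: image_image fun_eq_iff intro!: image_cong)
  have top: "openin weak_topology U \<longleftrightarrow> (\<exists>T. open T \<and> U = ?e -` T)" for U
    unfolding weak_topology_def by (simp add: openin_pullback_topology)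
  show ?thesis
  proof
    assume ?L
    moreover have "continuous_map weak_topology euclidean ?e"
      using top by (auto simp: continuous_map_def vimage_def)
    ultimately have "compactin euclidean (?e ` S)"
      by (rule image_compactin)
    then show ?R unfolding image by simp
  next
    assume R: ?R
    show ?L
      unfolding compactin_def
    proof (intro conjI allI impI)
      fix \<U> assume \<U>: "(\<forall>U\<in>\<U>. openin weak_topology U) \<and> S \<subseteq> \<Union> \<U>"
      define \<T> where "\<T> = {T. open T \<and> ?e -` T \<in> \<U>}"
      have "?e ` S \<subseteq> \<Union> \<T>"
      proof clarify
        fix x assume "x \<in> S"
        then obtain U where "U \<in> \<U>" "x \<in> U" using \<U> by blast
        moreover from this obtain T where "open T" "U = ?e -` T" using \<U> top by blast
        ultimately show "?e x \<in> \<Union> \<T>" unfolding \<T>_def by blast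
      qed
      moreover have "\<And>T. T \<in> \<T> \<Longrightarrow> open T" by (simp add: \<T>_def)
      ultimately obtain \<F> where "\<F> \<subseteq> \<T>" "finite \<F>" "?e ` S \<subseteq> \<Union> \<F>"
        using compactE[OF R[unfolded image]] by metis
      then show "\<exists>\<F>. finite \<F> \<and> \<F> \<subseteq> \<U> \<and> S \<subseteq> \<Union> \<F>"
        by (intro exI[of _ "(\<lambda>T. ?e -` T) ` \<F>"]) (auto simp: \<T>_def image_subset_iff)
    qed simp
  qed
qed

text \<open>The functionals of norm at most one are the linear functions in a product of compact intervals, and
linearity is a pointwise closed condition.\<close>

theorem Banach_Alaoglu:
  "compact (blinfun_apply ` cball (0 :: 'a::real_normed_vector \<Rightarrow>\<^sub>L real) 1)"
proof -
  let ?B = "{u :: 'a \<Rightarrow> real. \<forall>x. u x \<in> {- norm x..norm x}}"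
  let ?L = "{u :: 'a \<Rightarrow> real. \<forall>x y c. u (x + y) = u x + u y \<and> u (c *\<^sub>R x) = c * u x}"
  have "blinfun_apply ` cball (0 :: 'a \<Rightarrow>\<^sub>L real) 1 = ?B \<inter> ?L"
  proof (intro equalityI subsetI)
    fix u assume "u \<in> blinfun_apply ` cball (0 :: 'a \<Rightarrow>\<^sub>L real) 1"
    then obtain f :: "'a \<Rightarrow>\<^sub>L real" where "u = f" "norm f \<le> 1" by auto
    moreover have "\<bar>f x\<bar> \<le> norm x" for x
      using norm_blinfun[of f x] mult_right_mono[OF \<open>norm f \<le> 1\<close>, of "norm x"] by simp
    then have "f x \<le> norm x \<and> - norm x \<le> f x" for x
      by (meson abs_le_D1 abs_le_D2 minus_le_iff)
    ultimately show "u \<in> ?B \<inter> ?L"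
      by (simp add: blinfun.add_right blinfun.scaleR_right)
  next
    fix u assume u: "u \<in> ?B \<inter> ?L"
    then have bound: "\<bar>u x\<bar> \<le> norm x" for x by (auto simp: abs_le_iff minus_le_iff)
    have "bounded_linear u"
      using u bound by (intro bounded_linear_intro[where K=1]) auto
    then have eq: "blinfun_apply (Blinfun u) = u"
      by (rule bounded_linear_Blinfun_apply)
    then have "norm (Blinfun u) \<le> 1"
      using bound by (intro norm_blinfun_bound) auto
    then show "u \<in> blinfun_apply ` cball 0 1"
      using eq by (intro image_eqI[of _ _ "Blinfun u"]) auto
  qed
  moreover have "compact ?B"
  proof -
    have "compactin (product_topology (\<lambda>x. euclidean) UNIV) (PiE UNIV (\<lambda>x :: 'a. {- norm x..norm x}))"
      unfolding compactin_PiE by simp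
    then show ?thesis
      unfolding euclidean_product_topology by (simp add: PiE_UNIV_domain Pi_def)
  qed
  moreover have "closed ?L"
    by (intro closed_Collect_all closed_Collect_conj closed_Collect_eq continuous_intros
        continuous_on_coordinate)
  ultimately show ?thesis
    by (simp add: compact_Int_closed)
qed

text \<open>The pairs \<open>(k f, k g)\<close> with \<open>k \<in> K\<close> form a compact convex set in
the plane. A line strictly separating \<open>(\<phi> f, \<phi> g)\<close> from it would be a
linear combination of \<open>f\<close> and \<open>g\<close> that contradicts the hypothesis.

With \<open>g\<close> arbitrary, this says that the slice of \<open>K\<close> of the members that agree
with \<open>\<phi>\<close> at \<open>f\<close> inherits the hypothesis, which drives the induction
over finite sets of arguments.\<close>

lemma evaluation_fixing:
  fixes K :: "('a::real_normed_vector \<Rightarrow>\<^sub>L real) set" and \<phi> :: "'a \<Rightarrow>\<^sub>L real"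
  assumes K: "compact (blinfun_apply ` K)" "convex K"
    and dom: "\<And>f. \<exists>k\<in>K. \<phi> f \<le> k f"
  shows "\<exists>k\<in>K. k f = \<phi> f \<and> k g = \<phi> g"
proof -
  define S where "S = (\<lambda>k. (blinfun_apply k f, blinfun_apply k g)) ` K"
  have "S = (\<lambda>u. (u f, u g)) ` blinfun_apply ` K"
    unfolding S_def image_image ..
  then have "compact S"
    using K(1) by (auto intro!: compact_continuous_image continuous_intros continuous_on_coordinate)
  have "linear (\<lambda>k. (blinfun_apply k f, blinfun_apply k g))"
    by (rule linearI) (auto simp: blinfun.add_left blinfun.scaleR_left)
  then have "convex S"
    unfolding S_def using K(2) by (rule convex_linear_image)
  have "(\<phi> f, \<phi> g) \<in> S"
  proof (rule ccontr)
    assume "(\<phi> f, \<phi> g) \<notin> S"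
    then obtain a b where "inner a (\<phi> f, \<phi> g) < b" and gt: "\<forall>s\<in>S. inner a s > b"
      using separating_hyperplane_closed_point[OF \<open>convex S\<close> compact_imp_closed[OF \<open>compact S\<close>]]
      by blast
    obtain r s where a: "a = (r, s)" by (cases a)
    obtain k where "k \<in> K" and k: "\<phi> (- (r *\<^sub>R f + s *\<^sub>R g)) \<le> k (- (r *\<^sub>R f + s *\<^sub>R g))"
      using dom by blast
    have "r * k f + s * k g > b"
      using gt \<open>k \<in> K\<close> by (auto simp: S_def a)
    moreover have "r * \<phi> f + s * \<phi> g < b"
      using \<open>inner a (\<phi> f, \<phi> g) < b\<close> by (simp add: a)
    ultimately show False
      using k by (simp add: blinfun.minus_right blinfun.diff_right blinfun.add_right blinfun.scaleR_right)
  qed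
  then show ?thesis by (auto simp: S_def)
qed

lemma finite_evaluation_fixing:
  fixes K :: "('a::real_normed_vector \<Rightarrow>\<^sub>L real) set" and \<phi> :: "'a \<Rightarrow>\<^sub>L real"
  assumes "finite A" "compact (blinfun_apply ` K)" "convex K"
    and "\<And>f. \<exists>k\<in>K. \<phi> f \<le> k f"
  shows "\<exists>k\<in>K. \<forall>f\<in>A. k f = \<phi> f"
  using assms
proof (induction A arbitrary: K rule: finite_induct)
  case empty
  then show ?case by blast
next
  case (insert f A)
  let ?K = "{k \<in> K. k f = \<phi> f}"
  have "blinfun_apply ` ?K = blinfun_apply ` K \<inter> {u. u f = \<phi> f}"
    by auto
  then have "compact (blinfun_apply ` ?K)"
    using insert.prems(1)
    by (auto intro!: compact_Int_closed closed_Collect_eq continuous_on_coordinate continuous_intros)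
  moreover have "convex {k :: 'a \<Rightarrow>\<^sub>L real. k f = \<phi> f}"
    unfolding convex_def
    by (auto simp: blinfun.add_left blinfun.scaleR_left distrib_right[symmetric])
  then have "convex ?K"
    using insert.prems(2) convex_Int[of K "{k :: 'a \<Rightarrow>\<^sub>L real. k f = \<phi> f}"] by (simp add: Int_def)
  moreover have "\<exists>k\<in>?K. \<phi> g \<le> k g" for g
    using evaluation_fixing[OF insert.prems, of f g] by fastforce
  ultimately obtain k where "k \<in> ?K" "\<forall>g\<in>A. k g = \<phi> g"
    using insert.IH[of ?K] by blast
  then show ?case by auto
qed

text \<open>If no \<open>f\<close> separates, then \<open>\<phi>\<close> agrees with some member of
\<open>K\<close> on every finite set of arguments, and compactness makes it agree with one member
everywhere.\<close>

theorem weak_star_compact_separation: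
  fixes K :: "('a::real_normed_vector \<Rightarrow>\<^sub>L real) set"
  assumes K: "compact (blinfun_apply ` K)" "convex K" and "\<phi> \<notin> K"
  obtains f where "\<And>k. k \<in> K \<Longrightarrow> k f < \<phi> f"
proof (rule ccontr)
  assume "\<not> thesis"
  then have dom: "\<And>f. \<exists>k\<in>K. \<phi> f \<le> k f"
    using that by (meson not_le)
  have "blinfun_apply ` K \<inter> \<Inter>(range (\<lambda>f. {u. u f = \<phi> f})) \<noteq> {}"
  proof (rule compact_imp_fip[OF K(1)])
    fix T assume "T \<in> range (\<lambda>f. {u. u f = \<phi> f})"
    then show "closed T"
      by (auto intro!: closed_Collect_eq continuous_on_coordinate continuous_intros)
  next
    fix \<F> assume "finite \<F>" "\<F> \<subseteq> range (\<lambda>f. {u. u f = \<phi> f})"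
    then obtain A where "finite A" "\<F> = (\<lambda>f. {u. u f = \<phi> f}) ` A"
      by (meson finite_subset_image)
    moreover from this obtain k where "k \<in> K" "\<forall>f\<in>A. k f = \<phi> f"
      using finite_evaluation_fixing[OF _ K dom] by blast
    ultimately show "blinfun_apply ` K \<inter> \<Inter>\<F> \<noteq> {}" by auto
  qed
  then obtain k where "k \<in> K" "\<And>f. k f = \<phi> f" by auto
  then show False
    using \<open>\<phi> \<notin> K\<close> blinfun_eqI[of k \<phi>] by auto
qed

section \<open>The canonical embedding into the bidual\<close>

lemma linear_bidual_embedding: "linear bidual_embedding"
  by (rule linearI) (auto intro!: blinfun_eqI simp: blinfun.add_left blinfun.add_right
      blinfun.scaleR_left blinfun.scaleR_right)

lemma norm_bidual_embedding_le: "norm (bidual_embedding x) \<le> norm x"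
proof (rule norm_blinfun_bound)
  fix f :: "'a \<Rightarrow>\<^sub>L real"
  show "norm (bidual_embedding x f) \<le> norm x * norm f"
    using norm_blinfun[of f x] by (simp add: mult.commute)
qed simp

lemma norm_bidual_embedding [simp]: "norm (bidual_embedding x) = norm x"
proof (rule antisym)
  show "norm x \<le> norm (bidual_embedding x)"
  proof -
    \<comment> \<open>A functional of norm at most one above this ray attains the norm of \<open>x\<close>.\<close>
    define G where "G = {(t *\<^sub>R x, t * norm x) |t. t \<ge> 0}"
    have "convex_cone G"
      unfolding convex_cone_iff G_def
      by (auto simp: zero_prod_def scaleR_add_left[symmetric] distrib_right[symmetric]
          intro: exI[of _ 0] add_nonneg_nonneg mult_nonneg_nonneg)
    then obtain f :: "'a \<Rightarrow>\<^sub>L real" where "norm f \<le> 1" "\<And>c t. (c, t) \<in> G \<Longrightarrow> t \<le> f c"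
      by (rule sandwich_blinfun[where e=1]) (auto simp: G_def)
    then have "norm x \<le> f x"
      by (force simp: G_def intro: exI[of _ 1])
    also have "f x = bidual_embedding x f" by simp
    also have "\<dots> \<le> norm (bidual_embedding x) * norm f"
      using norm_blinfun[of "bidual_embedding x" f] by simp
    also have "\<dots> \<le> norm (bidual_embedding x)"
      using \<open>norm f \<le> 1\<close> by (simp add: mult_left_le)
    finally show ?thesis .
  qed
qed (rule norm_bidual_embedding_le)

text \<open>This is where completeness of the space enters: an isometric image of a complete space is complete.\<close>

lemma closed_range_bidual_embedding:
  "closed (range (bidual_embedding :: 'a::banach \<Rightarrow> _))"
proof -
  have "bounded_linear (bidual_embedding :: 'a \<Rightarrow> _)"
    by (intro bounded_linear_intro[where K=1])
      (auto simp: linear_add[OF linear_bidual_embedding] linear_scale[OF linear_bidual_embedding])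
  then have "complete (bidual_embedding ` (UNIV :: 'a set))"
    by (intro complete_isometric_image[where e=1]) (auto simp: subspace_UNIV complete_UNIV)
  then show ?thesis by (rule complete_imp_closed)
qed

section \<open>Cones whose dual cone is reflexive\<close>

text \<open>A functional that is almost nonnegative on \<open>P\<close> is close to the dual cone: the sandwich
between \<open>- f\<close> on \<open>P\<close> and \<open>e * norm\<close> gives a functional
of norm at most \<open>e\<close> whose addition to \<open>f\<close> makes it nonnegative on
\<open>P\<close>.\<close>

lemma near_dual_cone:
  fixes f :: "'a::real_normed_vector \<Rightarrow>\<^sub>L real"
  assumes P: "convex_cone P" and "e \<ge> 0" and f: "\<And>x. x \<in> P \<Longrightarrow> - e * norm x \<le> f x"
  obtains g where "g \<in> dual_cone P" and "norm (f - g) \<le> e"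
proof -
  have "linear (\<lambda>x. (x, - f x))"
    by (rule linearI) (auto simp: blinfun.add_right blinfun.scaleR_right)
  then have G: "convex_cone ((\<lambda>x. (x, - f x)) ` P)"
    using P convex_cone_linear_image by blast
  have below: "t \<le> e * norm c" if "(c, t) \<in> (\<lambda>x. (x, - f x)) ` P" for c t
    using that f by fastforce
  obtain h :: "'a \<Rightarrow>\<^sub>L real"
    where h: "norm h \<le> e" "\<And>c t. (c, t) \<in> (\<lambda>x. (x, - f x)) ` P \<Longrightarrow> t \<le> h c"
    using sandwich_blinfun[OF G \<open>e \<ge> 0\<close> below] by blast
  have "- f x \<le> h x" if "x \<in> P" for x
    using that by (intro h(2)) auto
  then have "f + h \<in> dual_cone P"
    unfolding dual_cone_def by (force simp: blinfun.add_left)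
  then show ?thesis
    using that[of "f + h"] h(1) by simp
qed

text \<open>This is the inequality \<open>dist (\<phi>, - J P) \<le> sup \<phi>\<close> for the bidual, where
\<open>J\<close> is the canonical embedding and the supremum is over the unit ball of the dual
cone. If it failed, then \<open>\<phi>\<close> would lie outside
\<open>K = d B - J (P \<inter> R B)\<close> for every radius \<open>R\<close>, where \<open>B\<close> is
the closed unit ball of the bidual in the first term and of the space itself in the second, and
\<open>K\<close> is weak-star compact because \<open>P\<close> is reflexive. A separating
\<open>f\<close> satisfies \<open>d * norm f \<le> \<phi> f\<close> and is nonnegative on
\<open>P\<close> up to an error of order \<open>1 / R\<close>, so by
\<open>near_dual_cone\<close> the dual cone contains a \<open>g\<close> close to \<open>f\<close>.
For \<open>R\<close> large, the bound \<open>\<phi> g \<le> s * norm g\<close> contradicts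
\<open>s < d\<close>.\<close>

lemma dual_cone_distance:
  fixes P :: "'a::real_normed_vector set" and \<phi> :: "('a \<Rightarrow>\<^sub>L real) \<Rightarrow>\<^sub>L real"
  assumes P: "reflexive_cone P"
    and s: "\<And>f. f \<in> dual_cone P \<Longrightarrow> norm f \<le> 1 \<Longrightarrow> \<phi> f \<le> s" and "s < d"
  obtains x where "x \<in> P" and "norm (\<phi> + bidual_embedding x) \<le> d"
proof (rule ccontr)
  assume "\<not> thesis"
  then have far: "\<And>x. x \<in> P \<Longrightarrow> norm (\<phi> + bidual_embedding x) > d"
    using that by (meson not_le)
  have cone: "convex_cone P" and comp: "compact (blinfun_apply ` bidual_embedding ` (P \<inter> cball 0 1))"
    using P by (auto simp: reflexive_cone_def compactin_weak_topology_iff)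
  have "s \<ge> 0"
    using s[of 0] by (simp add: dual_cone_def blinfun.zero_right)
  then have "d > 0" using \<open>s < d\<close> by simp
  let ?J = "bidual_embedding :: 'a \<Rightarrow> _"
  define N where "N = norm \<phi>"
  have "N \<ge> 0" by (simp add: N_def)
  \<comment> \<open>The estimates below end in \<open>d \<le> s + e * (s + N)\<close> with \<open>e = N / R\<close>; this
radius makes that false.\<close>
  define R where "R = N * (s + N) / (d - s) + 1"
  have "R \<ge> 1" using \<open>s \<ge> 0\<close> \<open>N \<ge> 0\<close> \<open>s < d\<close> by (simp add: R_def)
  define e where "e = N / R"
  have "e \<ge> 0" using \<open>N \<ge> 0\<close> \<open>R \<ge> 1\<close> by (simp add: e_def)
  have small: "e * (s + N) < d - s"
  proof -
    have "N * (s + N) = (R - 1) * (d - s)" using \<open>s < d\<close> by (simp add: R_def)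
    also have "\<dots> < R * (d - s)" using \<open>s < d\<close> by simp
    finally show ?thesis using \<open>R \<ge> 1\<close> by (simp add: e_def field_simps)
  qed
  define K where "K = (\<lambda>(\<psi>, \<xi>). d *\<^sub>R \<psi> - R *\<^sub>R \<xi>) ` (cball 0 1 \<times> ?J ` (P \<inter> cball 0 1))"
  have image_K: "blinfun_apply ` K = (\<lambda>(u, v) f. d * u f - R * v f) `
      (blinfun_apply ` cball 0 1 \<times> blinfun_apply ` ?J ` (P \<inter> cball 0 1))"
  proof -
    have "blinfun_apply ` K = (\<lambda>(\<psi>, \<xi>) f. d * blinfun_apply \<psi> f - R * blinfun_apply \<xi> f)
        ` (cball 0 1 \<times> ?J ` (P \<inter> cball 0 1))"
      unfolding K_def image_image
      by (intro image_cong) (auto simp: fun_eq_iff blinfun.diff_left blinfun.scaleR_left)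
    also have "\<dots> = (\<lambda>(u, v) f. d * u f - R * v f) `
        (map_prod blinfun_apply blinfun_apply ` (cball 0 1 \<times> ?J ` (P \<inter> cball 0 1)))"
      unfolding image_image by (intro image_cong) auto
    finally show ?thesis by (simp add: map_prod_surj_on)
  qed
  have cont: "continuous_on S (\<lambda>(u, v) f. d * u f - R * v f)"
    for S :: "((('a \<Rightarrow>\<^sub>L real) \<Rightarrow> real) \<times> (('a \<Rightarrow>\<^sub>L real) \<Rightarrow> real)) set"
    unfolding case_prod_unfold
    by (intro continuous_on_coordinatewise_then_product continuous_intros
        continuous_on_product_then_coordinatewise[OF continuous_on_fst]
        continuous_on_product_then_coordinatewise[OF continuous_on_snd])
  have "compact (blinfun_apply ` K)"
    unfolding image_K by (rule compact_continuous_image[OF cont compact_Times[OF Banach_Alaoglu comp]])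
  moreover have "convex K"
  proof -
    have "linear (\<lambda>(\<psi> :: ('a \<Rightarrow>\<^sub>L real) \<Rightarrow>\<^sub>L real, \<xi>). d *\<^sub>R \<psi> - R *\<^sub>R \<xi>)"
      by (rule linearI) (auto simp: algebra_simps)
    moreover have "convex (P \<inter> cball 0 1)"
      using cone by (simp add: convex_cone_def convex_Int)
    ultimately show ?thesis
      unfolding K_def
      by (intro convex_linear_image convex_Times convex_cball linear_bidual_embedding)
  qed
  moreover have "\<phi> \<notin> K"
  proof
    assume "\<phi> \<in> K"
    then obtain \<psi> x where "norm \<psi> \<le> 1" "x \<in> P" and eq: "\<phi> = d *\<^sub>R \<psi> - R *\<^sub>R ?J x"
      by (auto simp: K_def)
    then have "R *\<^sub>R x \<in> P" using convex_cone_scaleR[OF cone] \<open>R \<ge> 1\<close> by simp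
    moreover have "\<phi> + ?J (R *\<^sub>R x) = d *\<^sub>R \<psi>"
      by (simp add: eq linear_scale[OF linear_bidual_embedding])
    ultimately show False
      using far[of "R *\<^sub>R x"] \<open>norm \<psi> \<le> 1\<close> \<open>d > 0\<close> by (simp add: mult_left_le)
  qed
  ultimately obtain f where f: "\<And>k. k \<in> K \<Longrightarrow> k f < \<phi> f"
    by (rule weak_star_compact_separation) blast
  \<comment> \<open>Testing \<open>K\<close> at the images of \<open>y\<close> and \<open>x\<close>: varying \<open>y\<close>
bounds the norm of \<open>f\<close> above, varying \<open>x\<close> bounds \<open>f\<close> below on
\<open>P\<close>.\<close>
  have f': "d * f y - R * f x < \<phi> f" if "norm y \<le> 1" "x \<in> P" "norm x \<le> 1" for x y
  proof -
    have "d *\<^sub>R ?J y - R *\<^sub>R ?J x \<in> K"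
      unfolding K_def using that by (intro image_eqI[of _ _ "(?J y, ?J x)"]) auto
    from f[OF this] show ?thesis
      by (simp add: blinfun.diff_left blinfun.scaleR_left)
  qed
  have "0 \<in> P" using cone by (rule convex_cone_contains_0)
  have "\<phi> f > 0"
    using f'[of 0 0] \<open>0 \<in> P\<close> by (simp add: blinfun.zero_right)
  then have "norm f > 0"
    by (auto simp: blinfun.zero_right)
  have phi_le: "\<phi> h \<le> N * norm h" for h
    using norm_blinfun[of \<phi> h] by (simp add: N_def)
  have "norm f \<le> \<phi> f / d"
  proof (rule norm_blinfun_bound)
    fix y
    have *: "f z \<le> \<phi> f / d * norm z" for z
    proof (cases "z = 0")
      case False
      have "d * f ((1 / norm z) *\<^sub>R z) < \<phi> f"
        using f'[of "(1 / norm z) *\<^sub>R z" 0] \<open>0 \<in> P\<close> False by (simp add: blinfun.zero_right)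
      then show ?thesis
        using False \<open>d > 0\<close> by (simp add: blinfun.scaleR_right field_simps)
    qed (simp add: blinfun.zero_right)
    show "norm (f y) \<le> \<phi> f / d * norm y"
      using *[of y] *[of "- y"] by (simp add: blinfun.minus_right)
  qed (use \<open>\<phi> f > 0\<close> \<open>d > 0\<close> in simp)
  then have d_le: "d * norm f \<le> \<phi> f"
    using \<open>d > 0\<close> by (simp add: field_simps)
  have "- (e * norm f) * norm x \<le> f x" if "x \<in> P" for x
  proof (cases "x = 0")
    case False
    have "(1 / norm x) *\<^sub>R x \<in> P"
      using convex_cone_scaleR[OF cone] that by simp
    then have "- R * f ((1 / norm x) *\<^sub>R x) < \<phi> f"
      using f'[of 0 "(1 / norm x) *\<^sub>R x"] False by (simp add: blinfun.zero_right)
    also have "\<dots> \<le> N * norm f" by (rule phi_le)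
    finally show ?thesis
      using False \<open>R \<ge> 1\<close> by (simp add: e_def blinfun.scaleR_right field_simps)
  qed (simp add: blinfun.zero_right)
  then obtain g where g: "g \<in> dual_cone P" "norm (f - g) \<le> e * norm f"
    using near_dual_cone[OF cone, of "e * norm f" f] \<open>e \<ge> 0\<close> by auto
  have norm_g: "norm g \<le> (1 + e) * norm f"
    using g(2) norm_triangle_ineq2[of g f] by (simp add: norm_minus_commute algebra_simps)
  have "\<phi> g \<le> s * norm g"
  proof (cases "g = 0")
    case False
    have "(1 / norm g) *\<^sub>R g \<in> dual_cone P"
      using g(1) by (auto simp: dual_cone_def blinfun.scaleR_left)
    then have "\<phi> ((1 / norm g) *\<^sub>R g) \<le> s"
      using False by (intro s) auto
    then show ?thesis
      using False by (simp add: blinfun.scaleR_right field_simps)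
  qed (simp add: blinfun.zero_right)
  also have "\<dots> \<le> s * ((1 + e) * norm f)"
    using norm_g \<open>s \<ge> 0\<close> by (rule mult_left_mono)
  finally have "\<phi> g \<le> s * ((1 + e) * norm f)" .
  moreover have "\<phi> (f - g) \<le> N * (e * norm f)"
    using phi_le[of "f - g"] mult_left_mono[OF g(2) \<open>N \<ge> 0\<close>] by linarith
  ultimately have "\<phi> f \<le> (s + e * (s + N)) * norm f"
    by (simp add: blinfun.diff_right algebra_simps)
  with d_le have "d \<le> s + e * (s + N)"
    using \<open>norm f > 0\<close> by (meson mult_le_cancel_right_pos order_trans)
  with small show False by linarith
qed

text \<open>If \<open>F\<close> were outside the weakly compact set of evaluations at the unit ball of the dual
cone, some \<open>\<phi>\<close> would separate it: \<open>F \<phi>\<close> exceeds the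
maximum \<open>s\<close> of \<open>\<phi>\<close> on that ball. But \<open>F\<close> is
nonnegative on the image of \<open>P\<close>, so \<open>F \<phi>\<close> is at most the norm of
\<open>\<phi> + bidual_embedding x\<close> for every \<open>x \<in> P\<close>, and
\<open>dual_cone_distance\<close> makes these norms as close to \<open>s\<close> as required.\<close>

lemma third_dual_functional_represented:
  fixes P :: "'a::real_normed_vector set" and F :: "(('a \<Rightarrow>\<^sub>L real) \<Rightarrow>\<^sub>L real) \<Rightarrow>\<^sub>L real"
  assumes P: "reflexive_cone P" and W: "reflexive_cone (dual_cone P)"
    and "norm F \<le> 1" and nonneg: "\<And>x. x \<in> P \<Longrightarrow> F (bidual_embedding x) \<ge> 0"
  shows "F \<in> bidual_embedding ` dual_cone P"
proof (rule ccontr)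
  assume F: "F \<notin> bidual_embedding ` dual_cone P"
  let ?W = "dual_cone P \<inter> cball 0 1"
  have comp: "compact (blinfun_apply ` bidual_embedding ` ?W)"
    using W by (simp add: reflexive_cone_def compactin_weak_topology_iff)
  have "convex (bidual_embedding ` ?W)"
    using W by (intro convex_linear_image linear_bidual_embedding convex_Int)
      (auto simp: reflexive_cone_def convex_cone_def)
  then obtain \<phi> where \<phi>: "\<And>k. k \<in> bidual_embedding ` ?W \<Longrightarrow> k \<phi> < F \<phi>"
    using F weak_star_compact_separation[OF comp, of F] by blast
  have "0 \<in> ?W" by (simp add: dual_cone_def)
  obtain u where u: "u \<in> blinfun_apply ` bidual_embedding ` ?W"
      "\<forall>v\<in>blinfun_apply ` bidual_embedding ` ?W. v \<phi> \<le> u \<phi>"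
    using continuous_attains_sup[OF comp _ continuous_on_coordinate[of _ \<phi>]] \<open>0 \<in> ?W\<close> by blast
  define s where "s = u \<phi>"
  have "s < F \<phi>" using u(1) \<phi> unfolding s_def by blast
  have "\<phi> f \<le> s" if "f \<in> dual_cone P" "norm f \<le> 1" for f
    using u(2) that unfolding s_def by force
  then obtain d where "s < d" "d < F \<phi>" and "\<And>f. f \<in> dual_cone P \<Longrightarrow> norm f \<le> 1 \<Longrightarrow> \<phi> f \<le> s"
    using dense[OF \<open>s < F \<phi>\<close>] by blast
  then obtain x where x: "x \<in> P" "norm (\<phi> + bidual_embedding x) \<le> d"
    using dual_cone_distance[OF P, of \<phi> s d] by blast
  have "F \<phi> \<le> F (\<phi> + bidual_embedding x)"
    using nonneg[OF x(1)] by (simp add: blinfun.add_right)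
  also have "\<dots> \<le> norm F * norm (\<phi> + bidual_embedding x)"
    using norm_blinfun[of F "\<phi> + bidual_embedding x"] by simp
  also have "\<dots> \<le> d"
    using x(2) mult_right_mono[OF \<open>norm F \<le> 1\<close>, of "norm (\<phi> + bidual_embedding x)"] by simp
  finally show False using \<open>d < F \<phi>\<close> by simp
qed

lemma reflexive_space_if_reflexive_cones:
  fixes P :: "'a::banach set"
  assumes "reflexive_cone P" and "reflexive_cone (dual_cone P)"
  shows "reflexive_space TYPE('a)"
proof -
  let ?J = "bidual_embedding :: 'a \<Rightarrow> _"
  have "\<phi> \<in> range ?J" for \<phi>
  proof (rule ccontr)
    assume "\<phi> \<notin> range ?J"
    then obtain F :: "(('a \<Rightarrow>\<^sub>L real) \<Rightarrow>\<^sub>L real) \<Rightarrow>\<^sub>L real"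
      where F: "norm F \<le> 1" "\<And>m. m \<in> range ?J \<Longrightarrow> F m = 0" "F \<phi> \<noteq> 0"
      using annihilating_functional[OF _ closed_range_bidual_embedding]
        linear_subspace_image[OF linear_bidual_embedding subspace_UNIV] by blast
    then obtain f where f: "F = bidual_embedding f"
      using third_dual_functional_represented[OF assms F(1)] by fastforce
    have "f x = 0" for x
      using F(2)[of "?J x"] by (simp add: f)
    then have "f = 0" by (intro blinfun_eqI) simp
    then show False
      using F(3) by (simp add: f blinfun.zero_right)
  qed
  then show ?thesis
    unfolding reflexive_space_def by blast
qed

text \<open>In the dual of a reflexive space every bidual functional is an evaluation at a point, so the weak
and the weak-star topology coincide and the Banach-Alaoglu theorem applies. The map
\<open>T\<close> below reindexes pointwise convergence from points to bidual functionals.\<close>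

lemma reflexive_cone_dual_ball:
  assumes "reflexive_space TYPE('a::real_normed_vector)"
  shows "reflexive_cone (UNIV :: ('a \<Rightarrow>\<^sub>L real) set)"
proof -
  let ?J = "bidual_embedding :: 'a \<Rightarrow> _"
  define T where "T u \<phi> = u (inv ?J \<phi>)" for u :: "'a \<Rightarrow> real" and \<phi>
  have J_inv: "?J (inv ?J \<phi>) = \<phi>" for \<phi>
    using assms unfolding reflexive_space_def by (rule surj_f_inv_f)
  have "f (inv ?J \<phi>) = \<phi> f" for f :: "'a \<Rightarrow>\<^sub>L real" and \<phi>
    using J_inv[of \<phi>] by (metis blinfun_apply_bidual_embedding)
  then have "T f = bidual_embedding f" for f :: "'a \<Rightarrow>\<^sub>L real"
    by (simp add: T_def fun_eq_iff)
  then have image_T: "blinfun_apply ` bidual_embedding ` cball (0 :: 'a \<Rightarrow>\<^sub>L real) 1 = T ` blinfun_apply ` cball 0 1"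
    unfolding image_image by simp
  have cont: "continuous_on S T" for S
    unfolding T_def
    by (intro continuous_on_coordinatewise_then_product continuous_on_coordinate)
  have "compact (blinfun_apply ` bidual_embedding ` cball (0 :: 'a \<Rightarrow>\<^sub>L real) 1)"
    unfolding image_T by (rule compact_continuous_image[OF cont Banach_Alaoglu])
  then show ?thesis
    by (simp add: reflexive_cone_def compactin_weak_topology_iff convex_cone_iff)
qed

theorem theorem3p5:
  shows "reflexive_space TYPE('a::banach) \<longleftrightarrow>
    (\<exists>P :: 'a set. convex_cone P \<and> closed P \<and> reflexive_cone P \<and> reflexive_cone (dual_cone P))"
proof
  assume refl: "reflexive_space TYPE('a)"
  have "dual_cone {0 :: 'a} = UNIV"
    by (simp add: dual_cone_def blinfun.zero_right)
  moreover have "convex_cone {0 :: 'a}"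
    by (simp add: convex_cone_iff)
  moreover have "reflexive_cone {0 :: 'a}"
    using \<open>convex_cone {0 :: 'a}\<close> by (simp add: reflexive_cone_def finite_imp_compactin)
  ultimately show "\<exists>P :: 'a set. convex_cone P \<and> closed P \<and> reflexive_cone P \<and> reflexive_cone (dual_cone P)"
    using reflexive_cone_dual_ball[OF refl] by (intro exI[of _ "{0}"]) simp
next
  assume "\<exists>P :: 'a set. convex_cone P \<and> closed P \<and> reflexive_cone P \<and> reflexive_cone (dual_cone P)"
  then show "reflexive_space TYPE('a)"
    using reflexive_space_if_reflexive_cones by blast
qed

end
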